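(* Let $\mathbf{L}$ be any logic extending $\mathbf{B}$ up to $\mathbf{RM}$ (that is, lying between $\mathbf{B}$ and $\mathbf{RM}$). Then quantifier elimination fails for DLO (dense linear orderings without endpoints) in $\mathbf{L}$: there is a formula $A$ in the signature $\{<\}$ (with equality) such that for no quantifier-free formula $B$ do we have $\mathrm{DLO}\vDash_{\mathbf{L}} A\leftrightarrow B$.
   Context: Language: first-order formulas built with $\neg,\land,\lor,\rightarrow,\forall,\exists,\bot,\top$, in the signature with one binary predicate $<$, plus the logical predicate $=$. $A\leftrightarrow B$ abbreviates $(A\rightarrow B)\land(B\rightarrow A)$. A $\mathbf{B}$-frame is $\langle W,R,{}^*,s\rangle$ with $W\neq\varnothing$, $R\subseteq W^3$, ${}^*:W\to W$, $s\in W$, such that for all $\alpha,\beta,\gamma,\delta\in W$: $Rs\alpha\alpha$; $Rs\alpha\beta$ and $R\beta\gamma\delta$ imply $R\alpha\gamma\delta$; $\alpha^{**}=\alpha$; $Rs\alpha\beta$ implies $Rs\beta^*\alpha^*$. A $\mathbf{B}$-model $M=\langle W,R,D,{}^*,s,V\rangle$ adds a nonempty set $D$ and a valuation $V$ with $V(w,P)\subseteq D^n$ for each $w\in W$ and $n$-ary predicate $P$, such that $Rs\alpha\beta$ implies $V(\alpha,P)\subseteq V(\beta,P)$; the predicate $=$ is interpreted as real identity on $D$ at every world. Truth at a world $w$ under an assignment $\overline{a}$ of elements of $D$ to variables: atomic formulas according to $V(w,\cdot)$; $\top$ always, $\bot$ never; $\land,\lor$ as usual at $w$; $M,w\vDash\neg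 A[\overline a]$ iff $M,w^*\nvDash A[\overline a]$; $M,w\vDash (A\rightarrow B)[\overline a]$ iff for all $w_1,w_2$ with $Rww_1w_2$, $M,w_1\vDash A[\overline a]$ implies $M,w_2\vDash B[\overline a]$; $\forall x$, $\exists x$ range over $D$ at $w$. A formula with free variables holds at $w$ in $M$ (without assignment) if it holds under all assignments. An $\mathbf{RM}$-frame is a $\mathbf{B}$-frame such that for all $\alpha,\beta,\gamma,\delta$: $R\alpha\beta\gamma$ implies $R\alpha\gamma^*\beta^*$; $R\alpha\beta\gamma$ implies $R\beta\alpha\gamma$; $R\alpha\alpha\alpha$; if there is $x$ with $R\alpha\beta x$ and $Rx\gamma\delta$ then there is $y$ with $R\alpha y\delta$ and $R\beta\gamma y$; $R\alpha\beta\gamma$ implies $Rs\alpha\gamma$ or $Rs\beta\gamma$. A logic $\mathbf{L}$ extending $\mathbf{B}$ is given by a class of $\mathbf{B}$-frames ($\mathbf{L}$-frames); $\mathbf{L}$-models are the $\mathbf{B}$-models on $\mathbf{L}$-frames. $\mathbf{L}$ lies between $\mathbf{B}$ and $\mathbf{RM}$ if every $\mathbf{RM}$-frame is an $\mathbf{L}$-frame. $\Gamma\vDash_{\mathbf{L}}A$ means: for every $\mathbf{L}$-model $M$, if $M,s\vDash\Gamma$ then $M,s\vDash A$. DLO has the axioms: $\forall x(x<x\rightarrow\bot)$; $\forall x,y(x=y\lor x<y\lor y<x)$; $\forall x,y,z((x<y\land y<z)\rightarrow x<z)$; $\forall x,y(x<y\rightarrow\exists z(x<z\land z<y))$; $\forall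 x\exists y(x<y)$; $\forall x\exists y(y<x)$. A theory $T$ admits quantifier elimination in $\mathbf{L}$ if for every formula $A$ there is a quantifier-free formula $B$ with $T\vDash_{\mathbf{L}}A\leftrightarrow B$. *)

theory Defs
  imports Main
begin

datatype fm =
    Less nat nat
  | Eql nat nat
  | Bot
  | Top
  | Neg fm
  | Conj fm fm
  | Disj fm fm
  | Imp fm fm
  | All nat fm
  | Ex nat fm

definition Iff :: "fm \<Rightarrow> fm \<Rightarrow> fm" where
  "Iff A B = Conj (Imp A B) (Imp B A)"

primrec quantifier_free :: "fm \<Rightarrow> bool" where
  "quantifier_free (Less x y) = True"
| "quantifier_free (Eql x y) = True"
| "quantifier_free Bot = True"
| "quantifier_free Top = True"
| "quantifier_free (Neg A) = quantifier_free A"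
| "quantifier_free (Conj A B) = (quantifier_free A \<and> quantifier_free B)"
| "quantifier_free (Disj A B) = (quantifier_free A \<and> quantifier_free B)"
| "quantifier_free (Imp A B) = (quantifier_free A \<and> quantifier_free B)"
| "quantifier_free (All x A) = False"
| "quantifier_free (Ex x A) = False"

record 'w frame =
  worlds :: "'w set"
  acc :: "('w \<times> 'w \<times> 'w) set"
  star :: "'w \<Rightarrow> 'w"
  base :: 'w

locale B_frame =
  fixes F :: "'w frame"
  assumes acc_worlds: "acc F \<subseteq> worlds F \<times> worlds F \<times> worlds F"
    and star_worlds: "\<alpha> \<in> worlds F \<Longrightarrow> star F \<alpha> \<in> worlds F"
    and base_worlds: "base F \<in> worlds F"
    and acc_refl: "\<alpha> \<in> worlds F \<Longrightarrow> (base F, \<alpha>, \<alpha>) \<in> acc F"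
    and acc_mono: "(base F, \<alpha>, \<beta>) \<in> acc F \<Longrightarrow> (\<beta>, \<gamma>, \<delta>) \<in> acc F \<Longrightarrow> (\<alpha>, \<gamma>, \<delta>) \<in> acc F"
    and star_star: "\<alpha> \<in> worlds F \<Longrightarrow> star F (star F \<alpha>) = \<alpha>"
    and star_antimono: "(base F, \<alpha>, \<beta>) \<in> acc F \<Longrightarrow> (base F, star F \<beta>, star F \<alpha>) \<in> acc F"

locale RM_frame = B_frame +
  assumes acc_contrapos: "(\<alpha>, \<beta>, \<gamma>) \<in> acc F \<Longrightarrow> (\<alpha>, star F \<gamma>, star F \<beta>) \<in> acc F"
    and acc_commute: "(\<alpha>, \<beta>, \<gamma>) \<in> acc F \<Longrightarrow> (\<beta>, \<alpha>, \<gamma>) \<in> acc F"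
    and acc_diag: "\<alpha> \<in> worlds F \<Longrightarrow> (\<alpha>, \<alpha>, \<alpha>) \<in> acc F"
    and acc_assoc: "(\<alpha>, \<beta>, x) \<in> acc F \<Longrightarrow> (x, \<gamma>, \<delta>) \<in> acc F \<Longrightarrow>
      \<exists>y. (\<alpha>, y, \<delta>) \<in> acc F \<and> (\<beta>, \<gamma>, y) \<in> acc F"
    and acc_mingle: "(\<alpha>, \<beta>, \<gamma>) \<in> acc F \<Longrightarrow> (base F, \<alpha>, \<gamma>) \<in> acc F \<or> (base F, \<beta>, \<gamma>) \<in> acc F"

text \<open>The signature has a single nonlogical predicate, so a valuation assigns to each
  world just the extension of \<open><\<close>; equality is handled by the truth clauses.\<close>

record ('w, 'd) model =
  frame_of :: "'w frame"
  indivs :: "'d set"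
  val :: "'w \<Rightarrow> ('d \<times> 'd) set"

locale B_model =
  fixes M :: "('w, 'd) model"
  assumes frame: "B_frame (frame_of M)"
    and indivs_nonempty: "indivs M \<noteq> {}"
    and val_indivs: "w \<in> worlds (frame_of M) \<Longrightarrow> val M w \<subseteq> indivs M \<times> indivs M"
    and val_mono: "(base (frame_of M), \<alpha>, \<beta>) \<in> acc (frame_of M) \<Longrightarrow> val M \<alpha> \<subseteq> val M \<beta>"

primrec sat :: "('w, 'd) model \<Rightarrow> 'w \<Rightarrow> (nat \<Rightarrow> 'd) \<Rightarrow> fm \<Rightarrow> bool" where
  "sat M w a (Less x y) \<longleftrightarrow> (a x, a y) \<in> val M w"
| "sat M w a (Eql x y) \<longleftrightarrow> a x = a y"
| "sat M w a Bot \<longleftrightarrow> False"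
| "sat M w a Top \<longleftrightarrow> True"
| "sat M w a (Neg A) \<longleftrightarrow> \<not> sat M (star (frame_of M) w) a A"
| "sat M w a (Conj A B) \<longleftrightarrow> sat M w a A \<and> sat M w a B"
| "sat M w a (Disj A B) \<longleftrightarrow> sat M w a A \<or> sat M w a B"
| "sat M w a (Imp A B) \<longleftrightarrow>
    (\<forall>w1 w2. (w, w1, w2) \<in> acc (frame_of M) \<longrightarrow> sat M w1 a A \<longrightarrow> sat M w2 a B)"
| "sat M w a (All x A) \<longleftrightarrow> (\<forall>d \<in> indivs M. sat M w (a(x := d)) A)"
| "sat M w a (Ex x A) \<longleftrightarrow> (\<exists>d \<in> indivs M. sat M w (a(x := d)) A)"

definition holds :: "('w, 'd) model \<Rightarrow> 'w \<Rightarrow> fm \<Rightarrow> bool" where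
  "holds M w A \<longleftrightarrow> (\<forall>a. range a \<subseteq> indivs M \<longrightarrow> sat M w a A)"

text \<open>A logic is represented by its class of frames, here the frames whose worlds are drawn
  from the type \<^typ>\<open>'w\<close>. The type argument names the type from which the individuals of
  the models are drawn; it does not occur in the other arguments.\<close>

definition entails :: "'d itself \<Rightarrow> 'w frame set \<Rightarrow> fm set \<Rightarrow> fm \<Rightarrow> bool" where
  "entails _ L \<Gamma> A \<longleftrightarrow>
    (\<forall>M :: ('w, 'd) model. B_model M \<and> frame_of M \<in> L \<longrightarrow>
      (\<forall>G \<in> \<Gamma>. holds M (base (frame_of M)) G) \<longrightarrow> holds M (base (frame_of M)) A)"

definition admits_qe :: "'d itself \<Rightarrow> 'w frame set \<Rightarrow> fm set \<Rightarrow> bool" where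
  "admits_qe D L T \<longleftrightarrow> (\<forall>A. \<exists>B. quantifier_free B \<and> entails D L T (Iff A B))"

definition DLO :: "fm set" where
  "DLO =
    {All 0 (Imp (Less 0 0) Bot),
     All 0 (All 1 (Disj (Eql 0 1) (Disj (Less 0 1) (Less 1 0)))),
     All 0 (All 1 (All 2 (Imp (Conj (Less 0 1) (Less 1 2)) (Less 0 2)))),
     All 0 (All 1 (Imp (Less 0 1) (Ex 2 (Conj (Less 0 2) (Less 2 1))))),
     All 0 (Ex 1 (Less 0 1)),
     All 0 (Ex 1 (Less 1 0))}"

end

theory Submission
  imports Defs "HOL-Library.Countable"
begin

text \<open>Irreflexivity \<open>x < x \<rightarrow> \<bottom>\<close> is an entailment at the base world, so it rules out
  \<open>x < x\<close> at every world. Hence, when all variables denote one and the same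
  individual \<open>d\<close>, the atoms \<open>x < y\<close> are false and the atoms \<open>x = y\<close> true at every world,
  and the truth value of a quantifier-free formula at any given world does not depend
  on \<open>d\<close> (\<open>quantifier_free_diagonal\<close>).

  A quantified formula can do better, because the axioms of DLO that are not implications
  (linearity and the absence of endpoints) constrain only the base world \<open>s\<close> and
  the worlds above it. In the frame of the three-valued logic \<open>RM3\<close>, which consists of \<open>s\<close> and a world
  \<open>t = s\<^sup>*\<close> strictly below it, \<open><\<close> may be the order of the rationals at \<open>s\<close>, while at \<open>t\<close> it is
  this order restricted to the negative rationals. This restriction is still irreflexive,
  transitive and dense, so DLO holds at \<open>s\<close>. But at \<open>t\<close> the formula \<open>\<exists>y. x < y\<close> is true of
  the negative numbers and false of the others, whereas a formula equivalent to it under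
  DLO would have to agree with it at \<open>t\<close> too, since \<open>R s t t\<close>. As the \<open>RM3\<close> frame is an
  \<open>RM\<close>-frame, this refutes quantifier elimination in every logic below \<open>RM\<close>.\<close>

lemma quantifier_free_diagonal:
  assumes "quantifier_free B"
    and "\<And>w. (d, d) \<in> val M w \<longleftrightarrow> (e, e) \<in> val M w"
  shows "sat M w (\<lambda>_. d) B \<longleftrightarrow> sat M w (\<lambda>_. e) B"
  using assms(1)
proof (induction B arbitrary: w)
  case (Less x y)
  show ?case by (simp add: assms(2))
qed auto

text \<open>The forbidden triple expresses that \<open>s\<close> is not below \<open>t\<close>; every other triple is forced
  by the conditions on \<open>RM\<close>-frames once \<open>t = s\<^sup>*\<close> and \<open>t \<noteq> s\<close>.\<close>

definition RM3_frame :: "'w \<Rightarrow> 'w \<Rightarrow> 'w frame" where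
  "RM3_frame s t =
    \<lparr>worlds = {s, t},
     acc = {s, t} \<times> {s, t} \<times> {s, t} - {(s, s, t)},
     star = (\<lambda>w. if w = s then t else s),
     base = s\<rparr>"

lemma RM3_frame_simps [simp]:
  "worlds (RM3_frame s t) = {s, t}"
  "acc (RM3_frame s t) = {s, t} \<times> {s, t} \<times> {s, t} - {(s, s, t)}"
  "star (RM3_frame s t) = (\<lambda>w. if w = s then t else s)"
  "base (RM3_frame s t) = s"
  by (simp_all add: RM3_frame_def)

lemma RM_frame_RM3_frame:
  assumes "s \<noteq> t"
  shows "RM_frame (RM3_frame s t)"
proof unfold_locales
  fix \<alpha> \<beta> \<gamma> \<delta> x
  assume *: "(\<alpha>, \<beta>, x) \<in> acc (RM3_frame s t)" "(x, \<gamma>, \<delta>) \<in> acc (RM3_frame s t)"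
  \<comment> \<open>The choice \<open>y = s\<close> fails only if \<open>R \<alpha> s \<delta>\<close> is the forbidden triple; then \<open>y = t\<close> works.\<close>
  show "\<exists>y. (\<alpha>, y, \<delta>) \<in> acc (RM3_frame s t) \<and> (\<beta>, \<gamma>, y) \<in> acc (RM3_frame s t)"
    by (rule exI[of _ "if \<alpha> = s \<and> \<delta> = t then t else s"]) (use * assms in auto)
qed (use assms in auto)

text \<open>An injection \<open>f\<close> transports the rational order into the given type of individuals, so that
  one construction serves all infinite types.\<close>

definition truncated_order_model :: "'w \<Rightarrow> 'w \<Rightarrow> (rat \<Rightarrow> 'd) \<Rightarrow> ('w, 'd) model" where
  "truncated_order_model s t f =
    \<lparr>frame_of = RM3_frame s t,
     indivs = range f,
     val = (\<lambda>w. {(f p, f q) | p q. p < q \<and> (w = s \<or> q < 0)})\<rparr>"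

lemma truncated_order_model_simps [simp]:
  "frame_of (truncated_order_model s t f) = RM3_frame s t"
  "indivs (truncated_order_model s t f) = range f"
  by (simp_all add: truncated_order_model_def)

lemma val_truncated_order_model [simp]:
  assumes "inj f"
  shows "(f p, f q) \<in> val (truncated_order_model s t f) w \<longleftrightarrow> p < q \<and> (w = s \<or> q < 0)"
  using assms by (auto simp: truncated_order_model_def inj_eq)

lemma B_model_truncated_order_model:
  assumes "s \<noteq> t"
  shows "B_model (truncated_order_model s t f)"
proof (rule B_model.intro)
  show "B_frame (frame_of (truncated_order_model s t f))"
    using RM_frame_RM3_frame[OF assms] by (simp add: RM_frame_def)
qed (use assms in \<open>auto simp: truncated_order_model_def\<close>)

text \<open>Density survives at the lower world because the point found between \<open>p\<close> and \<open>q\<close> is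
  negative whenever \<open>q\<close> is.\<close>

lemma truncated_order_model_DLO:
  assumes "s \<noteq> t" and "inj f" and "G \<in> DLO"
  shows "holds (truncated_order_model s t f) s G"
proof -
  have dense_neg: "\<exists>r>p. r < 0 \<and> r < q" if "p < q" and "q < 0" for p q :: rat
    using dense[OF that(1)] that(2) by (meson less_trans)
  show ?thesis
    using assms(3,1,2) unfolding DLO_def holds_def
    by (auto simp: inj_eq dense dense_neg lt_ex gt_ex dest: less_trans)
qed

theorem theorem5:
  fixes L :: "'w frame set"
  assumes "infinite (UNIV :: 'w set)"
    and "infinite (UNIV :: 'd set)"
    and "\<And>F. F \<in> L \<Longrightarrow> B_frame F"
    and "\<And>F. RM_frame F \<Longrightarrow> F \<in> L"
  shows "\<not> admits_qe TYPE('d) L DLO"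
proof
  assume "admits_qe TYPE('d) L DLO"
  then obtain B where qf: "quantifier_free B"
    and equiv: "entails TYPE('d) L DLO (Iff (Ex 1 (Less 0 1)) B)"
    unfolding admits_qe_def by blast
  obtain s t :: 'w where "s \<noteq> t"
    using assms(1) by (metis (full_types) UNIV_eq_I finite.emptyI finite.insertI singleton_iff)
  obtain g :: "nat \<Rightarrow> 'd" where "inj g"
    using infinite_countable_subset[OF assms(2)] by blast
  define f :: "rat \<Rightarrow> 'd" where "f = g \<circ> to_nat"
  have "inj f"
    unfolding f_def using \<open>inj g\<close> by (intro inj_compose) auto
  define M where "M = truncated_order_model s t f"
  have "holds M s (Iff (Ex 1 (Less 0 1)) B)"
    using equiv B_model_truncated_order_model[OF \<open>s \<noteq> t\<close>, of f]
      truncated_order_model_DLO[OF \<open>s \<noteq> t\<close> \<open>inj f\<close>] assms(4)[OF RM_frame_RM3_frame[OF \<open>s \<noteq> t\<close>]]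
    unfolding entails_def M_def by fastforce
  then have sat_base: "sat M s (\<lambda>_. f p) (Iff (Ex 1 (Less 0 1)) B)" for p
    unfolding holds_def by (simp add: M_def image_subset_iff)
  have agree: "sat M t (\<lambda>_. f p) (Ex 1 (Less 0 1)) \<longleftrightarrow> sat M t (\<lambda>_. f p) B" for p
  proof -
    have "(s, t, t) \<in> acc (frame_of M)"
      using \<open>s \<noteq> t\<close> by (simp add: M_def)
    with sat_base[of p] show ?thesis
      unfolding Iff_def sat.simps(6,8) by blast
  qed
  have "sat M t (\<lambda>_. f p) (Ex 1 (Less 0 1)) \<longleftrightarrow> p < 0" for p
    using \<open>s \<noteq> t\<close> \<open>inj f\<close> dense[of p 0] by (auto simp: M_def)
  with agree have "sat M t (\<lambda>_. f p) B \<longleftrightarrow> p < 0" for p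
    by blast
  moreover have "sat M t (\<lambda>_. f (-1)) B \<longleftrightarrow> sat M t (\<lambda>_. f 0) B"
    using \<open>inj f\<close> by (intro quantifier_free_diagonal[OF qf]) (simp add: M_def)
  ultimately show False
    by simp
qed

end
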